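(* Let $\mathbb F$ be a field of characteristic zero, let $(A,\cdot)$ be a $4$-dimensional binary Lie algebra over $\mathbb F$ which is not a Lie algebra, let $u\in A$, and let $\ast$ be the Kantor square of $\cdot$ with respect to $u$. Then $(A,\ast)$ is a nilpotent Lie algebra, which is isomorphic to the ($4$-dimensional, anticommutative) algebra with multiplication table $e_1e_2=e_3$.
   Context: An algebra is a vector space with a bilinear multiplication, not assumed associative; $xy:=x\cdot y$. For a fixed $u\in A$, the Kantor square of $\cdot$ (with respect to $u$) is the multiplication $x\ast y:=u(xy)-(ux)y-x(uy)$ on $A$. Put $J(x,y,z)=(xy)z+(zx)y+(yz)x$. A binary Lie algebra is an algebra satisfying $xy=-yx$ and $J(xy,x,y)=0$ for all $x,y$. A multiplication table is given on a basis $e_1,e_2,e_3,e_4$; zero products are omitted, and products that follow by anticommutativity (here $e_2e_1=-e_3$) are not listed.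
   Formalization: The isomorphism with the algebra e1e2=e3 is claimed only when the Kantor square is not the zero multiplication; for u=0 (and some nonzero u) the Kantor square is zero and the claim fails. That it is a nilpotent Lie algebra is claimed for every u. *)

theory Defs
  imports "HOL-Analysis.Cartesian_Space"
begin

locale nonassoc_algebra = vector_space scale
  for scale :: "'f::field \<Rightarrow> 'a::ab_group_add \<Rightarrow> 'a" +
  fixes mult :: "'a \<Rightarrow> 'a \<Rightarrow> 'a"
  assumes linear_right: "Vector_Spaces.linear scale scale (\<lambda>y. mult x y)"
    and linear_left: "Vector_Spaces.linear scale scale (\<lambda>x. mult x y)"

definition jacobian :: "('a \<Rightarrow> 'a \<Rightarrow> 'a) \<Rightarrow> 'a \<Rightarrow> 'a \<Rightarrow> 'a \<Rightarrow> 'a::ab_group_add" where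
  "jacobian mult x y z = mult (mult x y) z + mult (mult z x) y + mult (mult y z) x"

(* Anticommutativity is x y = - (y x); this is equivalent to x x = 0 only away from characteristic 2. *)
locale lie_algebra = nonassoc_algebra scale mult
  for scale :: "'f::field \<Rightarrow> 'a::ab_group_add \<Rightarrow> 'a" and mult +
  assumes anticommute: "mult x y = - mult y x"
    and jacobi: "jacobian mult x y z = 0"

locale binary_lie_algebra = nonassoc_algebra scale mult
  for scale :: "'f::field \<Rightarrow> 'a::ab_group_add \<Rightarrow> 'a" and mult +
  assumes anticommute: "mult x y = - mult y x"
    and binary_jacobi: "jacobian mult (mult x y) x y = 0"

definition kantor_square :: "('a \<Rightarrow> 'a \<Rightarrow> 'a) \<Rightarrow> 'a \<Rightarrow> 'a \<Rightarrow> 'a \<Rightarrow> 'a::ab_group_add" where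
  "kantor_square mult u x y = mult u (mult x y) - mult (mult u x) y - mult x (mult u y)"

(* If u annihilates the jacobian, in particular for u = 0, the Kantor square with respect to u is
   the zero multiplication. *)
lemma (in nonassoc_algebra) kantor_square_zero: "kantor_square mult 0 x y = 0"
proof -
  have r: "mult z 0 = 0" and l: "mult 0 z = 0" for z
    using module_hom.zero[OF linear_right[of z, unfolded module_hom_iff_linear[symmetric]]]
      module_hom.zero[OF linear_left[of z, unfolded module_hom_iff_linear[symmetric]]]
    by simp_all
  show ?thesis by (simp add: kantor_square_def l r)
qed

primrec (in nonassoc_algebra) lower_central :: "nat \<Rightarrow> 'a set" where
  "lower_central 0 = UNIV"
| "lower_central (Suc n) = span {mult x y | x y. y \<in> lower_central n}"

locale nilpotent_lie_algebra = lie_algebra scale mult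
  for scale :: "'f::field \<Rightarrow> 'a::ab_group_add \<Rightarrow> 'a" and mult +
  assumes nilpotent: "\<exists>n. lower_central n = {0}"

definition algebra_isomorphic ::
    "('f::field \<Rightarrow> 'a::ab_group_add \<Rightarrow> 'a) \<Rightarrow> ('a \<Rightarrow> 'a \<Rightarrow> 'a) \<Rightarrow>
     ('f \<Rightarrow> 'b::ab_group_add \<Rightarrow> 'b) \<Rightarrow> ('b \<Rightarrow> 'b \<Rightarrow> 'b) \<Rightarrow> bool" where
  "algebra_isomorphic smult mult smult' mult' \<longleftrightarrow>
     (\<exists>f. Vector_Spaces.linear smult smult' f \<and> bij f \<and> (\<forall>x y. f (mult x y) = mult' (f x) (f y)))"

(* The bilinear multiplication on F^n with prescribed products T i j of the standard basis vectors. *)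
definition table_mult ::
    "('n::finite \<Rightarrow> 'n \<Rightarrow> ('f::field) ^ 'n) \<Rightarrow> 'f ^ 'n \<Rightarrow> 'f ^ 'n \<Rightarrow> 'f ^ 'n" where
  "table_mult T x y = (\<Sum>i\<in>UNIV. \<Sum>j\<in>UNIV. (x $ i * y $ j) *s T i j)"

definition e1e2_table :: "4 \<Rightarrow> 4 \<Rightarrow> ('f::field) ^ 4" where
  "e1e2_table i j =
     (if i = 1 \<and> j = 2 then axis 3 1
      else if i = 2 \<and> j = 1 then - axis 3 1
      else 0)"

end

theory Submission imports Defs begin

text \<open>
  Anticommutativity turns the Kantor square into a Jacobian: \<open>x * y = - J u x y\<close>. The Jacobian is
  trilinear and alternating, so in dimension four it is a linear map from a four-dimensional
  space of 3-vectors to the algebra. The theorem follows once this map is shown to be highly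
  degenerate: there is a vector \<open>v\<close> such that all Jacobians are multiples of \<open>v\<close> and every Jacobian
  with an entry \<open>v\<close> vanishes (\<open>jacobian_axis\<close>).

  To find \<open>v\<close>, start from \<open>J x y t \<noteq> 0\<close>. The polarized identity \<open>J (x y) x z = - J (x z) x y\<close>
  forbids the span of \<open>x, y, t\<close> from containing all three products \<open>x y, y t, t x\<close>
  (\<open>some_product_outside_span\<close>): with all three in the span, their coefficients are so constrained
  that \<open>J x y t\<close> cancels. So, up to a cyclic permutation, \<open>x, y, t, x y\<close> is a basis. The
  binary Jacobi identity and its polarization show that a suitable combination \<open>v\<close> of \<open>x y, x, y\<close>
  lies in the radical of \<open>J\<close>, and they prescribe the shape of the multiplication table in the basis \<open>x, y, t, v\<close>: for a linear functional
  \<open>f\<close>, the product of \<open>z\<close> and \<open>z'\<close> is \<open>f z \<cdot> z' - f z' \<cdot> z\<close> modulo \<open>v\<close>. The equation \<open>J x y v = 0\<close>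
  forces \<open>f v = 0\<close>, that is, \<open>v\<close> spans an ideal. Products of the form \<open>f z \<cdot> z' - f z' \<cdot> z\<close>
  satisfy the Jacobi identity, so all Jacobians vanish modulo \<open>v\<close>
  (\<open>jacobian_axis_of_product_outside_span\<close>).

  Given \<open>v\<close>, the Kantor square takes values in a central line, hence is Lie and nilpotent. If \<open>p * q\<close> is
  nonzero, then \<open>u\<close> is a second central direction, because \<open>J\<close> is alternating, and
  \<open>p, q, p * q, u\<close> is a basis realizing the table \<open>e\<^sub>1 e\<^sub>2 = e\<^sub>3\<close>
  (\<open>isomorphic_to_e1e2_table\<close>).
\<close>

section \<open>Coordinates and trilinearity of the Jacobian\<close>

context vector_space
begin

lemma coordinates_of_four_independent:
  assumes dim4: "dim (UNIV :: 'b set) = 4"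
    and indep: "\<And>\<alpha> \<beta> \<gamma> \<delta>. scale \<alpha> a + scale \<beta> b + scale \<gamma> c + scale \<delta> d = 0 \<Longrightarrow>
      \<alpha> = 0 \<and> \<beta> = 0 \<and> \<gamma> = 0 \<and> \<delta> = 0"
  obtains \<alpha> \<beta> \<gamma> \<delta> where "z = scale \<alpha> a + scale \<beta> b + scale \<gamma> c + scale \<delta> d"
proof -
  obtain B where B: "independent B" "UNIV \<subseteq> span B" "card B = dim (UNIV :: 'b set)"
    using basis_exists[of UNIV] by blast
  then have "finite B" using dim4 by (metis card.infinite zero_neq_numeral)
  then interpret fd: finite_dimensional_vector_space scale B
    using B by unfold_locales auto
  have distinct: "a \<noteq> b" "a \<noteq> c" "a \<noteq> d" "b \<noteq> c" "b \<noteq> d" "c \<noteq> d"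
    using indep[of 1 "-1" 0 0] indep[of 1 0 "-1" 0] indep[of 1 0 0 "-1"]
      indep[of 0 1 "-1" 0] indep[of 0 1 0 "-1"] indep[of 0 0 1 "-1"] by auto
  have "independent {a, b, c, d}"
    using distinct indep by (simp add: dependent_finite add.assoc) metis
  then have "UNIV \<subseteq> span {a, b, c, d}"
    using distinct dim4 by (intro fd.card_ge_dim_independent) auto
  then have "z \<in> span {a, b, c, d}" by blast
  then obtain \<alpha> \<beta> \<gamma> \<delta> where
    "z - scale \<alpha> a - scale \<beta> b - scale \<gamma> c - scale \<delta> d = 0"
    unfolding span_breakdown_eq by auto
  then show thesis by (intro that[of \<alpha> \<beta> \<gamma> \<delta>]) (simp add: algebra_simps)
qed

end

context nonassoc_algebra
begin

lemma
  shows mult_add_right: "mult x (y + z) = mult x y + mult x z"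
    and mult_scale_right: "mult x (scale c y) = scale c (mult x y)"
    and mult_add_left: "mult (x + y) z = mult x z + mult y z"
    and mult_scale_left: "mult (scale c x) z = scale c (mult x z)"
  using linear_right[of x] linear_left[of z] by (simp_all add: Vector_Spaces.linear_iff)

lemma
  shows mult_zero_right: "mult x 0 = 0"
    and mult_zero_left: "mult 0 x = 0"
    and mult_minus_right: "mult x (- y) = - mult x y"
    and mult_minus_left: "mult (- x) y = - mult x y"
    and mult_diff_right: "mult x (y - z) = mult x y - mult x z"
    and mult_diff_left: "mult (x - y) z = mult x z - mult y z"
  using mult_scale_right[of x 0 0] mult_scale_left[of 0 0 x]
    mult_scale_right[of x "-1"] mult_scale_left[of "-1"]
    mult_add_right[of x y "- z"] mult_add_left[of x "- y" z]
  by simp_all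

lemmas mult_linear = mult_add_right mult_scale_right mult_add_left mult_scale_left
  mult_zero_right mult_zero_left mult_minus_right mult_minus_left mult_diff_right mult_diff_left

lemma jacobian_cyclic: "jacobian mult y z x = jacobian mult x y z"
  by (simp add: jacobian_def algebra_simps)

lemma jacobian_linear:
  "jacobian mult (x + x') y z = jacobian mult x y z + jacobian mult x' y z"
  "jacobian mult (x - x') y z = jacobian mult x y z - jacobian mult x' y z"
  "jacobian mult (- x) y z = - jacobian mult x y z"
  "jacobian mult (scale c x) y z = scale c (jacobian mult x y z)"
  "jacobian mult x (y + y') z = jacobian mult x y z + jacobian mult x y' z"
  "jacobian mult x (y - y') z = jacobian mult x y z - jacobian mult x y' z"
  "jacobian mult x (- y) z = - jacobian mult x y z"
  "jacobian mult x (scale c y) z = scale c (jacobian mult x y z)"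
  "jacobian mult x y (z + z') = jacobian mult x y z + jacobian mult x y z'"
  "jacobian mult x y (z - z') = jacobian mult x y z - jacobian mult x y z'"
  "jacobian mult x y (- z) = - jacobian mult x y z"
  "jacobian mult x y (scale c z) = scale c (jacobian mult x y z)"
  by (simp_all add: jacobian_def mult_linear algebra_simps)

end

section \<open>The Jacobian of a binary Lie algebra\<close>

text \<open>Away from characteristic 2, anticommutativity gives \<open>x x = 0\<close>, which makes the Jacobian
  alternating.\<close>

locale odd_binary_lie_algebra = binary_lie_algebra scale mult
  for scale :: "'f::field \<Rightarrow> 'a::ab_group_add \<Rightarrow> 'a" and mult +
  assumes two_nonzero: "(2 :: 'f) \<noteq> 0"
begin

notation scale (infixr "\<cdot>" 75)
notation mult (infixl "\<odot>" 70)

abbreviation J :: "'a \<Rightarrow> 'a \<Rightarrow> 'a \<Rightarrow> 'a" where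
  "J \<equiv> jacobian mult"

lemma mult_self: "x \<odot> x = 0"
proof -
  have "2 \<cdot> (x \<odot> x) = 0"
    using anticommute[of x x] scale_left_distrib[of 1 1 "x \<odot> x"]
    by (simp add: eq_neg_iff_add_eq_0)
  then show ?thesis using two_nonzero by simp
qed

lemma jacobian_swap: "J y x z = - J x y z"
  using anticommute[of y x] anticommute[of x z] anticommute[of z y]
  by (simp add: jacobian_def mult_minus_left)

lemma jacobian_repeated: "J x x z = 0" "J x z x = 0" "J z x x = 0"
proof -
  show "J x x z = 0" for x z
    using anticommute[of x z] by (simp add: jacobian_def mult_self mult_linear)
  then show "J x z x = 0" "J z x x = 0" 
    by (metis jacobian_cyclic)+
qed

lemma binary_jacobi_polarized: "J (x \<odot> y) x z = - J (x \<odot> z) x y"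
  using binary_jacobi[of x "y + z"] binary_jacobi[of x y] binary_jacobi[of x z]
  by (simp add: jacobian_linear mult_linear add_eq_0_iff)

section \<open>The axis of the Jacobian in dimension four\<close>

text \<open>If all three products stay in the span, binary Jacobi removes from each product the component
  along the third vector, and the polarized identity then makes the remaining coefficients agree in
  pairs up to sign: the products become \<open>f z \<cdot> z' - f z' \<cdot> z\<close> for a linear functional \<open>f\<close>, which
  defines a Lie algebra.\<close>

lemma some_product_outside_span:
  assumes nz: "J x y t \<noteq> 0"
    and xy: "x \<odot> y = \<alpha>1 \<cdot> x + \<beta>1 \<cdot> y + \<gamma>1 \<cdot> t"
    and yt: "y \<odot> t = \<alpha>2 \<cdot> x + \<beta>2 \<cdot> y + \<gamma>2 \<cdot> t"
    and tx: "t \<odot> x = \<alpha>3 \<cdot> x + \<beta>3 \<cdot> y + \<gamma>3 \<cdot> t"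
  shows False
proof -
  let ?w = "J x y t"
  have perm: "J y t x = ?w" "J t x y = ?w" "J y x t = - ?w" "J x t y = - ?w" "J t y x = - ?w"
    by (metis jacobian_cyclic jacobian_swap)+
  have flip: "y \<odot> x = - (x \<odot> y)" "t \<odot> y = - (y \<odot> t)" "x \<odot> t = - (t \<odot> x)"
    by (rule anticommute)+
  note simps = jacobian_linear jacobian_repeated perm flip xy yt tx
  have "\<gamma>1 = 0" "\<alpha>2 = 0" "\<beta>3 = 0"
    using binary_jacobi[of x y] binary_jacobi[of y t] binary_jacobi[of t x] nz
    by (simp_all add: simps)
  moreover have "(- \<beta>1) \<cdot> ?w = \<gamma>3 \<cdot> ?w" "(- \<gamma>2) \<cdot> ?w = \<alpha>1 \<cdot> ?w" "(- \<alpha>3) \<cdot> ?w = \<beta>2 \<cdot> ?w"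
    using binary_jacobi_polarized[of x y t] binary_jacobi_polarized[of y t x]
      binary_jacobi_polarized[of t x y]
    by (simp_all add: simps)
  then have "\<gamma>3 = - \<beta>1" "\<gamma>2 = - \<alpha>1" "\<alpha>3 = - \<beta>2"
    using nz by (auto simp del: scale_minus_left)
  ultimately have "?w = 0"
    unfolding jacobian_def by (simp add: xy yt tx flip mult_linear mult_self algebra_simps)
  then show False using nz by simp
qed

text \<open>By the polarized identity, the Jacobians of \<open>x y\<close> with two of \<open>x, y, t\<close> are multiples of
  \<open>J x y t\<close>, so subtracting a combination of \<open>x\<close> and \<open>y\<close> from \<open>x y\<close> produces a radical vector \<open>v\<close>,
  the axis. The coefficients of \<open>x, y, t\<close> in the table of the basis \<open>x, y, t, v\<close> are
  read off by pairing a product against two of \<open>x, y, t\<close> in the Jacobian.\<close>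

lemma jacobian_axis_of_product_outside_span:
  assumes dim4: "dim (UNIV :: 'a set) = 4"
    and nz: "J x y t \<noteq> 0"
    and outside: "\<And>\<alpha> \<beta> \<gamma>. x \<odot> y \<noteq> \<alpha> \<cdot> x + \<beta> \<cdot> y + \<gamma> \<cdot> t"
  obtains v where "\<And>p q. J v p q = 0" "\<And>p q r. \<exists>c. J p q r = c \<cdot> v"
proof -
  let ?w = "J x y t"
  have perm: "J y t x = ?w" "J t x y = ?w" "J y x t = - ?w" "J x t y = - ?w" "J t y x = - ?w"
    by (metis jacobian_cyclic jacobian_swap)+
  have flip: "y \<odot> x = - (x \<odot> y)" "t \<odot> y = - (y \<odot> t)" "t \<odot> x = - (x \<odot> t)"
    by (rule anticommute)+
  note simps = jacobian_linear jacobian_repeated perm flip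
  have comb_xyt: "J (\<alpha> \<cdot> x + \<beta> \<cdot> y + \<gamma> \<cdot> t) y t = \<alpha> \<cdot> ?w"
    "J (\<alpha> \<cdot> x + \<beta> \<cdot> y + \<gamma> \<cdot> t) x t = - (\<beta> \<cdot> ?w)"
    "J (\<alpha> \<cdot> x + \<beta> \<cdot> y + \<gamma> \<cdot> t) x y = \<gamma> \<cdot> ?w" for \<alpha> \<beta> \<gamma>
    by (simp_all add: simps)
  have indep_xyt: "\<alpha> = 0 \<and> \<beta> = 0 \<and> \<gamma> = 0" if "\<alpha> \<cdot> x + \<beta> \<cdot> y + \<gamma> \<cdot> t = 0" for \<alpha> \<beta> \<gamma>
    using comb_xyt[of \<alpha> \<beta> \<gamma>] nz unfolding that by (simp add: jacobian_def mult_linear)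
  have indep: "\<alpha> = 0 \<and> \<beta> = 0 \<and> \<gamma> = 0 \<and> \<delta> = 0"
    if eq: "\<alpha> \<cdot> x + \<beta> \<cdot> y + \<gamma> \<cdot> t + \<delta> \<cdot> (x \<odot> y) = 0" for \<alpha> \<beta> \<gamma> \<delta>
  proof (cases "\<delta> = 0")
    case True
    then show ?thesis using eq indep_xyt by simp
  next
    case False
    have "\<delta> \<cdot> (x \<odot> y) = - (\<alpha> \<cdot> x + \<beta> \<cdot> y + \<gamma> \<cdot> t)"
      using eq by (simp add: eq_neg_iff_add_eq_0 algebra_simps)
    then have "inverse \<delta> \<cdot> (\<delta> \<cdot> (x \<odot> y)) = inverse \<delta> \<cdot> (- (\<alpha> \<cdot> x + \<beta> \<cdot> y + \<gamma> \<cdot> t))"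
      by simp
    then have "x \<odot> y = (- (inverse \<delta> * \<alpha>)) \<cdot> x + (- (inverse \<delta> * \<beta>)) \<cdot> y + (- (inverse \<delta> * \<gamma>)) \<cdot> t"
      using False by (simp add: algebra_simps)
    then show ?thesis using outside by blast
  qed
  (* The coefficients a and b of t in x t and y t determine the Jacobians of x y with x, t and y, t. *)
  obtain a a1 a2 a4 where "x \<odot> t = a1 \<cdot> x + a2 \<cdot> y + a \<cdot> t + a4 \<cdot> (x \<odot> y)"
    using coordinates_of_four_independent[OF dim4 indep] by metis
  then have "J (x \<odot> t) x y = a \<cdot> ?w"
    by (simp add: simps binary_jacobi)
  then have Jzxt: "J (x \<odot> y) x t = - (a \<cdot> ?w)"
    using binary_jacobi_polarized[of x y t] by simp
  obtain b b1 b2 b4 where "y \<odot> t = b1 \<cdot> x + b2 \<cdot> y + b \<cdot> t + b4 \<cdot> (x \<odot> y)"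
    using coordinates_of_four_independent[OF dim4 indep] by metis
  then have "J (y \<odot> t) x y = b \<cdot> ?w" "J (y \<odot> t) y x = - (b \<cdot> ?w)"
    using binary_jacobi[of y x] by (simp_all add: simps binary_jacobi)
  then have "- J (x \<odot> y) y t = b \<cdot> ?w"
    using binary_jacobi_polarized[of y x t] by (simp add: simps)
  then have Jzyt: "J (x \<odot> y) y t = - (b \<cdot> ?w)"
    by (metis minus_minus)
  (* The correction by x and y is chosen so that J v x t and J v y t vanish. *)
  define v where "v = x \<odot> y + b \<cdot> x - a \<cdot> y"
  have v_perm: "J p v q = - J v p q" "J p q v = J v p q" for p q
    by (metis jacobian_cyclic jacobian_swap)+
  have v_xy: "J v x y = 0" and v_xt: "J v x t = 0" and v_yt: "J v y t = 0"
    by (simp_all add: v_def simps binary_jacobi Jzxt Jzyt)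
  then have v_xy': "J v y x = 0" and v_xt': "J v t x = 0" and v_yt': "J v t y = 0"
    by (metis jacobian_cyclic jacobian_swap neg_equal_0_iff_equal)+
  have v_nz: "v \<noteq> 0"
  proof
    assume "v = 0"
    then have "x \<odot> y = (- b) \<cdot> x + a \<cdot> y + 0 \<cdot> t" by (simp add: v_def algebra_simps eq_neg_iff_add_eq_0)
    then show False using outside by blast
  qed
  note Jv = v_perm v_xy v_xt v_yt v_xy' v_xt' v_yt'
  note Jsimps = simps Jv
  have comb: "J (\<alpha> \<cdot> x + \<beta> \<cdot> y + \<gamma> \<cdot> t + \<delta> \<cdot> v) y t = \<alpha> \<cdot> ?w"
    "J (\<alpha> \<cdot> x + \<beta> \<cdot> y + \<gamma> \<cdot> t + \<delta> \<cdot> v) x t = - (\<beta> \<cdot> ?w)"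
    "J (\<alpha> \<cdot> x + \<beta> \<cdot> y + \<gamma> \<cdot> t + \<delta> \<cdot> v) x y = \<gamma> \<cdot> ?w" for \<alpha> \<beta> \<gamma> \<delta>
    by (simp_all add: Jsimps)
  have indep_v: "\<alpha> = 0 \<and> \<beta> = 0 \<and> \<gamma> = 0 \<and> \<delta> = 0"
    if eq: "\<alpha> \<cdot> x + \<beta> \<cdot> y + \<gamma> \<cdot> t + \<delta> \<cdot> v = 0" for \<alpha> \<beta> \<gamma> \<delta>
  proof -
    have "\<alpha> = 0 \<and> \<beta> = 0 \<and> \<gamma> = 0"
      using comb[of \<alpha> \<beta> \<gamma> \<delta>] nz unfolding eq by (simp add: jacobian_def mult_linear)
    then show ?thesis using eq v_nz by simp
  qed
  note coords = coordinates_of_four_independent[OF dim4 indep_v]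
  have radical: "J v p q = 0" for p q
  proof -
    obtain p1 p2 p3 p4 where p: "p = p1 \<cdot> x + p2 \<cdot> y + p3 \<cdot> t + p4 \<cdot> v" by (rule coords)
    obtain q1 q2 q3 q4 where q: "q = q1 \<cdot> x + q2 \<cdot> y + q3 \<cdot> t + q4 \<cdot> v" by (rule coords)
    show ?thesis unfolding p q by (simp add: Jsimps)
  qed
  then have radical': "J p v q = 0" "J p q v = 0" for p q
    by (simp_all add: v_perm)
  have xy: "x \<odot> y = v - b \<cdot> x + a \<cdot> y" by (simp add: v_def)
  (* Modulo v the products of x, y, t are f z z' - f z' z with f x = a, f y = b, f t = - p. *)
  obtain p p2 p3 p4 where xt0: "x \<odot> t = p \<cdot> x + p2 \<cdot> y + p3 \<cdot> t + p4 \<cdot> v" by (rule coords)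
  have "p2 = 0"
    using binary_jacobi[of x t] nz unfolding xt0 comb by simp
  moreover have "p3 = a"
    using \<open>J (x \<odot> t) x y = a \<cdot> ?w\<close> nz unfolding xt0 comb by simp
  ultimately have xt: "x \<odot> t = p \<cdot> x + a \<cdot> t + p4 \<cdot> v" by (simp add: xt0)
  obtain q1 q q3 q4 where yt0: "y \<odot> t = q1 \<cdot> x + q \<cdot> y + q3 \<cdot> t + q4 \<cdot> v" by (rule coords)
  have "q1 = 0"
    using binary_jacobi[of y t] nz unfolding yt0 comb by simp
  moreover have "q3 = b"
    using \<open>J (y \<odot> t) x y = b \<cdot> ?w\<close> nz unfolding yt0 comb by simp
  moreover have "q = p"
    using binary_jacobi_polarized[of t x y] nz
    by (simp add: flip xt yt0 Jsimps)
  ultimately have yt: "y \<odot> t = p \<cdot> y + b \<cdot> t + q4 \<cdot> v" by (simp add: yt0)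
  (* Modulo v, right multiplication by v maps every vector to a multiple of itself, so it is a
     scalar l; the polarized form polar below identifies the eigenvalues of x, y and t. *)
  have eigen: "J (z \<odot> v) z r = 0" for z r
    using binary_jacobi_polarized[of z v r] by (simp add: radical')
  obtain l x2 x3 m where xv0: "x \<odot> v = l \<cdot> x + x2 \<cdot> y + x3 \<cdot> t + m \<cdot> v" by (rule coords)
  have "x2 = 0" "x3 = 0"
    using eigen[of x t] eigen[of x y] nz unfolding xv0 comb by simp_all
  then have xv: "x \<odot> v = l \<cdot> x + m \<cdot> v" by (simp add: xv0)
  have polar: "J (z \<odot> v) z' r = - J (z' \<odot> v) z r" for z z' r
    using eigen[of "z + z'" r] eigen[of z r] eigen[of z' r]
    by (simp add: mult_linear jacobian_linear add_eq_0_iff)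
  obtain y1 l' y3 n where yv0: "y \<odot> v = y1 \<cdot> x + l' \<cdot> y + y3 \<cdot> t + n \<cdot> v" by (rule coords)
  have "y1 = 0" "y3 = 0" 
    using eigen[of y t] eigen[of y x] nz unfolding yv0 by (simp_all add: Jsimps)
  moreover have "l' = l"
    using polar[of x y t] nz unfolding yv0 xv by (simp add: Jsimps)
  ultimately have yv: "y \<odot> v = l \<cdot> y + n \<cdot> v" by (simp add: yv0)
  obtain t1 t2 l'' k where tv0: "t \<odot> v = t1 \<cdot> x + t2 \<cdot> y + l'' \<cdot> t + k \<cdot> v" by (rule coords)
  have "t1 = 0" "t2 = 0" 
    using eigen[of t y] eigen[of t x] nz unfolding tv0 by (simp_all add: Jsimps)
  moreover have "l'' = l"
    using polar[of x t y] nz unfolding tv0 xv by (simp add: Jsimps)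
  ultimately have tv: "t \<odot> v = l \<cdot> t + k \<cdot> v" by (simp add: tv0)
  have flip_v: "v \<odot> z = - (z \<odot> v)" for z by (rule anticommute)
  (* If l were nonzero, the coefficients of x and y in J x y v = 0 would give n = b and m = a, and
     then the coefficient of v would be - 2 l. *)
  have Jxyv: "J x y v = (l * (b - n)) \<cdot> x + (l * (m - a)) \<cdot> y + 0 \<cdot> t + (a * n - b * m) \<cdot> v - l \<cdot> v - l \<cdot> v"
    unfolding jacobian_def
    by (simp add: xy yv xv flip_v flip mult_linear mult_self algebra_simps)
  have "l * (b - n) = 0 \<and> l * (m - a) = 0 \<and> (0::'f) = 0 \<and> a * n - b * m - (l + l) = 0"
  proof (rule indep_v)
    have double: "(l + l) \<cdot> v = l \<cdot> v + l \<cdot> v" by (rule scale_left_distrib)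
    show "(l * (b - n)) \<cdot> x + (l * (m - a)) \<cdot> y + 0 \<cdot> t + (a * n - b * m - (l + l)) \<cdot> v = 0"
      unfolding scale_left_diff_distrib[of "a * n - b * m"] double
      using Jxyv radical'(2)[of x y] by (simp only: diff_diff_eq add_diff_eq)
  qed
  then have "l = 0"
    using two_nonzero by (cases "l = 0") (auto simp: mult.commute mult_2[symmetric])
  (* With l = 0 the line of v is an ideal, and the Jacobian of x, y, t vanishes modulo it. *)
  then have "?w = (p4 * n - q4 * m - k) \<cdot> v
      - (b * p4) \<cdot> v - (b * p4) \<cdot> v + (a * q4) \<cdot> v + (a * q4) \<cdot> v - p \<cdot> v - p \<cdot> v"
    unfolding jacobian_def
    by (simp add: xy xt yt xv yv tv flip_v flip mult_linear mult_self algebra_simps)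
  then have w: "?w \<in> span {v}" by (simp add: span_add span_diff span_scale span_base)
  have "J p q r \<in> span {v}" for p q r
  proof -
    obtain p1 p2 p3 p4 where p: "p = p1 \<cdot> x + p2 \<cdot> y + p3 \<cdot> t + p4 \<cdot> v" by (rule coords)
    obtain q1 q2 q3 q4 where q: "q = q1 \<cdot> x + q2 \<cdot> y + q3 \<cdot> t + q4 \<cdot> v" by (rule coords)
    obtain r1 r2 r3 r4 where r: "r = r1 \<cdot> x + r2 \<cdot> y + r3 \<cdot> t + r4 \<cdot> v" by (rule coords)
    have r_line: "J x y r \<in> span {v}" "J x t r \<in> span {v}" "J y t r \<in> span {v}"
      unfolding r by (simp_all add: simps radical' w span_add span_scale span_neg)
    moreover have "J y x r = - J x y r" "J t x r = - J x t r" "J t y r = - J y t r"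
      by (rule jacobian_swap)+
    ultimately show ?thesis
      unfolding p q by (simp add: jacobian_linear jacobian_repeated radical radical'
          span_add span_diff span_scale span_neg span_zero)
  qed
  then have "\<exists>d. J p q r = d \<cdot> v" for p q r
    unfolding span_singleton by blast
  with radical show thesis by (rule that)
qed

lemma jacobian_axis:
  assumes dim4: "dim (UNIV :: 'a set) = 4"
  obtains v where "\<And>p q. J v p q = 0" "\<And>p q r. \<exists>c. J p q r = c \<cdot> v"
proof (cases "\<forall>x y t. J x y t = 0")
  case True
  then show thesis by (intro that[of 0]) auto
next
  case False
  then obtain x y t where nz: "J x y t \<noteq> 0" by blast
  then have nz': "J y t x \<noteq> 0" "J t x y \<noteq> 0" by (metis jacobian_cyclic)+
  consider "\<And>\<alpha> \<beta> \<gamma>. x \<odot> y \<noteq> \<alpha> \<cdot> x + \<beta> \<cdot> y + \<gamma> \<cdot> t"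
    | "\<And>\<alpha> \<beta> \<gamma>. y \<odot> t \<noteq> \<alpha> \<cdot> x + \<beta> \<cdot> y + \<gamma> \<cdot> t"
    | "\<And>\<alpha> \<beta> \<gamma>. t \<odot> x \<noteq> \<alpha> \<cdot> x + \<beta> \<cdot> y + \<gamma> \<cdot> t"
    using some_product_outside_span[OF nz] by metis
  then show thesis
  proof cases
    case 1
    show thesis by (rule jacobian_axis_of_product_outside_span[OF dim4 nz 1 that])
  next
    case 2
    then have "y \<odot> t \<noteq> \<beta> \<cdot> y + \<gamma> \<cdot> t + \<alpha> \<cdot> x" for \<alpha> \<beta> \<gamma> by (simp add: add.commute add.left_commute)
    then show thesis by (rule jacobian_axis_of_product_outside_span[OF dim4 nz'(1) _ that])
  next
    case 3
    then have "t \<odot> x \<noteq> \<gamma> \<cdot> t + \<alpha> \<cdot> x + \<beta> \<cdot> y" for \<alpha> \<beta> \<gamma> by (simp add: add.commute add.left_commute)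
    then show thesis by (rule jacobian_axis_of_product_outside_span[OF dim4 nz'(2) _ that])
  qed
qed

section \<open>Algebras with products in a central line\<close>

lemma kantor_square_eq_jacobian: "kantor_square mult u x y = - J u x y"
  using anticommute[of u "x \<odot> y"] anticommute[of x "u \<odot> y"] anticommute[of u y]
  by (simp add: kantor_square_def jacobian_def mult_linear)

end

lemma (in lie_algebra) nilpotent_if_image_in_central_line:
  assumes image: "\<And>x y. \<exists>c. mult x y = scale c v"
    and central: "\<And>x. mult x v = 0"
  shows "nilpotent_lie_algebra scale mult"
proof
  have "mult x y = 0" if y: "y \<in> lower_central 1" for x y
  proof -
    have "lower_central 1 \<subseteq> span {v}"
    proof -
      have "{mult x y | x y. y \<in> (UNIV :: 'a set)} \<subseteq> span {v}"
      proof clarify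
        fix x y
        obtain c where "mult x y = scale c v" using image by blast
        then show "mult x y \<in> span {v}" by (simp add: span_scale span_base)
      qed
      then show ?thesis by (simp add: span_minimal)
    qed
    then obtain c where "y = scale c v" using y unfolding span_singleton by blast
    then show ?thesis by (simp add: mult_linear central)
  qed
  moreover have "0 \<in> lower_central 1" by (simp add: span_zero)
  ultimately have "{mult x y |x y. y \<in> lower_central 1} = {0}" by (auto, metis)
  then have "lower_central 2 = {0}" by (simp add: numeral_2_eq_2)
  then show "\<exists>n. lower_central n = {0}" by blast
qed

lemma table_mult_e1e2:
  "table_mult e1e2_table x y = axis 3 (x $ 1 * y $ 2 - x $ 2 * y $ 1)"
  by (simp add: table_mult_def e1e2_table_def sum_4 vec_eq_iff axis_def)

text \<open>Such a product is \<open>v\<close> times an alternating form whose radical contains \<open>v\<close> and \<open>u\<close>. Being nonzero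
  in dimension four, the form has rank 2, so the algebra is a Heisenberg algebra plus the
  line of \<open>u\<close>. The hypothesis on squares replaces a restriction to characteristic other than 2.\<close>

lemma (in lie_algebra) isomorphic_to_e1e2_table:
  assumes dim4: "dim (UNIV :: 'a set) = 4"
    and self: "\<And>x. mult x x = 0"
    and image: "\<And>x y. \<exists>c. mult x y = scale c v"
    and v_central: "\<And>x. mult x v = 0"
    and u_central: "\<And>x. mult x u = 0"
    and u_outside: "\<And>c. u \<noteq> scale c v"
    and pq: "mult p q \<noteq> 0"
  shows "algebra_isomorphic scale mult ((*s) :: 'f \<Rightarrow> 'f ^ 4 \<Rightarrow> 'f ^ 4) (table_mult e1e2_table)"
proof -
  obtain c where c: "mult p q = scale c v" using image by blast
  have v_central': "mult v x = 0" and u_central': "mult u x = 0" for x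
    using v_central[of x] u_central[of x] anticommute[of v x] anticommute[of u x] by simp_all
  have qp: "mult q p = - mult p q" by (rule anticommute)
  note simps = mult_linear self v_central u_central v_central' u_central' qp
  (* The isomorphism is the inverse of g, which sends the standard basis to p, q, p q, u. *)
  define g :: "'f ^ 4 \<Rightarrow> 'a" where
    "g w = scale (w $ 1) p + scale (w $ 2) q + scale (w $ 3) (mult p q) + scale (w $ 4) u" for w
  have indep: "\<alpha> = 0 \<and> \<beta> = 0 \<and> \<gamma> = 0 \<and> \<delta> = 0"
    if eq: "scale \<alpha> p + scale \<beta> q + scale \<gamma> (mult p q) + scale \<delta> u = 0" (is "?s = 0") for \<alpha> \<beta> \<gamma> \<delta>
  proof -
    have "mult ?s q = scale \<alpha> (mult p q)" "mult p ?s = scale \<beta> (mult p q)"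
      by (simp_all add: c simps)
    then have "\<alpha> = 0" "\<beta> = 0" unfolding eq using pq by (simp_all add: mult_linear)
    then have u: "scale \<delta> u = scale (- (\<gamma> * c)) v"
      using eq by (simp add: c eq_neg_iff_add_eq_0 add.commute)
    have "\<delta> = 0"
    proof (rule ccontr)
      assume "\<delta> \<noteq> 0"
      then have "u = scale (inverse \<delta> * - (\<gamma> * c)) v"
        using arg_cong[OF u, of "scale (inverse \<delta>)"] by simp
      then show False using u_outside by blast
    qed
    then show ?thesis using eq pq \<open>\<alpha> = 0\<close> \<open>\<beta> = 0\<close> by simp
  qed
  have g_add: "g (w + w') = g w + g w'" and g_diff: "g (w - w') = g w - g w'" 
    and g_scale: "g (k *s w) = scale k (g w)" for k w w'
    by (simp_all add: g_def algebra_simps)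
  have "inj g"
  proof (rule injI)
    fix w w' assume "g w = g w'"
    then have "g (w - w') = 0" by (simp add: g_diff)
    then have "(w - w') $ 1 = 0 \<and> (w - w') $ 2 = 0 \<and> (w - w') $ 3 = 0 \<and> (w - w') $ 4 = 0"
      unfolding g_def by (rule indep)
    then show "w = w'" by (simp add: vec_eq_iff forall_4)
  qed
  moreover have "surj g"
    unfolding surj_def
  proof
    fix z
    obtain \<alpha> \<beta> \<gamma> \<delta> where "z = scale \<alpha> p + scale \<beta> q + scale \<gamma> (mult p q) + scale \<delta> u"
      by (rule coordinates_of_four_independent[OF dim4 indep])
    then have "z = g (\<chi> i. if i = 1 then \<alpha> else if i = 2 then \<beta> else if i = 3 then \<gamma> else \<delta>)"
      by (simp add: g_def)
    then show "\<exists>w. z = g w" by blast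
  qed
  ultimately have "bij g" by (rule bijI)
  define f where "f = inv g"
  have gf: "g (f x) = x" and fg: "f (g w) = w" for x w
    using \<open>bij g\<close> by (simp_all add: f_def bij_is_surj surj_f_inv_f bij_is_inj)
  have g_mult: "g (table_mult e1e2_table w w') = mult (g w) (g w')" for w w'
    unfolding table_mult_e1e2
    by (simp add: g_def axis_def c simps algebra_simps)
  show ?thesis unfolding algebra_isomorphic_def
  proof (intro exI conjI allI)
    show "Vector_Spaces.linear scale (*s) f"
    proof (unfold Vector_Spaces.linear_iff, intro conjI allI)
      show "f (x + y) = f x + f y" for x y
        using fg[of "f x + f y"] by (simp add: g_add gf)
      show "f (scale k x) = k *s f x" for k x
        using fg[of "k *s f x"] by (simp add: g_scale gf)
    qed (fact vector_space_axioms vec.vector_space_axioms)+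
    show "bij f" using \<open>bij g\<close> by (simp add: f_def bij_imp_bij_inv)
    show "f (mult x y) = table_mult e1e2_table (f x) (f y)" for x y
      using fg[of "table_mult e1e2_table (f x) (f y)"] by (simp add: g_mult gf)
  qed
qed

theorem proposition24:
  fixes scale :: "'f::field_char_0 \<Rightarrow> 'a::ab_group_add \<Rightarrow> 'a"
    and mult :: "'a \<Rightarrow> 'a \<Rightarrow> 'a"
    and u :: 'a
  assumes "binary_lie_algebra scale mult"
    and "Vector_Spaces.vector_space.dim scale (UNIV :: 'a set) = 4"
    and "\<not> lie_algebra scale mult"
  shows "nilpotent_lie_algebra scale (kantor_square mult u) \<and>
    ((\<exists>x y. kantor_square mult u x y \<noteq> 0) \<longrightarrow>
      algebra_isomorphic scale (kantor_square mult u)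
        ((*s) :: 'f \<Rightarrow> 'f ^ 4 \<Rightarrow> 'f ^ 4) (table_mult e1e2_table))"
proof -
  interpret A: binary_lie_algebra scale mult by (rule assms(1))
  interpret A: odd_binary_lie_algebra scale mult by unfold_locales simp
  obtain v where v_radical: "\<And>p q. A.J v p q = 0" and image: "\<And>p q r. \<exists>c. A.J p q r = scale c v"
    using A.jacobian_axis[OF assms(2)] by blast
  let ?K = "kantor_square mult u"
  have K_image: "\<exists>c. ?K x y = scale c v" for x y
    using image[of u x y] by (metis A.kantor_square_eq_jacobian A.scale_minus_left)
  have K_v: "?K x v = 0" "?K v x = 0" for x
    by (metis A.kantor_square_eq_jacobian A.jacobian_cyclic v_radical neg_equal_0_iff_equal A.jacobian_swap)+
  have K_linear: "?K (x + y) z = ?K x z + ?K y z" "?K x (y + z) = ?K x y + ?K x z"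
    "?K (scale c x) y = scale c (?K x y)" "?K x (scale c y) = scale c (?K x y)" for c x y z
    by (simp_all add: A.kantor_square_eq_jacobian A.jacobian_linear)
  have K_swap: "?K x y = - ?K y x" for x y
    using A.jacobian_swap[of u y x] A.jacobian_cyclic by (metis A.kantor_square_eq_jacobian A.jacobian_swap)
  have K_K: "?K (?K x y) z = 0" for x y z
  proof -
    obtain c where "?K x y = scale c v" using K_image by blast
    then show ?thesis by (simp add: K_linear K_v)
  qed
  interpret K: lie_algebra scale ?K
    by unfold_locales
      (auto simp: linear_iff A.vector_space_axioms K_linear jacobian_def K_K intro: K_swap)
  have "algebra_isomorphic scale ?K ((*s) :: 'f \<Rightarrow> 'f ^ 4 \<Rightarrow> 'f ^ 4) (table_mult e1e2_table)"
    if pq: "?K p q \<noteq> 0" for p q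
  proof (rule K.isomorphic_to_e1e2_table[OF assms(2) _ K_image K_v(1) _ _ pq])
    show "?K x x = 0" "?K x u = 0" for x
      by (simp_all add: A.kantor_square_eq_jacobian A.jacobian_repeated)
    show "u \<noteq> scale c v" for c
      using pq by (auto simp: A.kantor_square_eq_jacobian A.jacobian_linear v_radical)
  qed
  then show ?thesis
    using K.nilpotent_if_image_in_central_line[OF K_image K_v(1)] by blast
qed

end
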